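(* Let $a_i,b_i,c_i,d_i$ ($i=1,2$) be integers such that every $2\times2$ minor of the matrix $$M=\begin{bmatrix}a_1&b_1&c_1&d_1\\ a_2&b_2&c_2&d_2\end{bmatrix}$$ is non-zero. Then the system of Diophantine equations $$a_1x^2+b_1y^2+c_1z^2=d_1,\qquad a_2x^2+b_2y^2+c_2z^2=d_2$$ has only finitely many integer solutions $(x,y,z)$. *)

theory Defs
  imports Main
begin

end

theory Submission
  imports Defs Complex_Main
    "HOL-Computational_Algebra.Polynomial_Factorial" "HOL-Computational_Algebra.Field_as_Ring"
begin

text \<open>
  Eliminating variables turns the system into \<open>N + a\<^sub>j = w\<^sub>j r\<^sub>j\<^sup>2\<close> (\<open>j = 0, 1, 2\<close>) with distinct integers
  \<open>a\<^sub>j\<close>, where \<open>N\<close> is a nonzero multiple of \<open>x\<^sup>2\<close>. We show that it has no two solutions \<open>(N, r)\<close> and \<open>(M, s)\<close>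
  with \<open>N\<close> large and \<open>M > N\<^sup>1\<^sup>4\<close>, by Hermite--Pade approximation of \<open>(N + z)\<^sup>1\<^sup>/\<^sup>2\<close> at the nodes.

  For \<open>k > 0\<close> interpolate the function given near \<open>a\<^sub>j\<close> by
  \<open>w\<^sub>j r\<^sub>j s\<^sub>j (N + a\<^sub>j)\<^sup>-\<^sup>1\<^sup>/\<^sup>2 (N + z)\<^sup>k\<^sup>+\<^sup>1\<^sup>/\<^sup>2\<close> to order \<open>k\<close> at every node, and to order \<open>k + 1\<close> at one of them. Its
  Taylor coefficients at the nodes are rational with denominators powers of 4, so the leading
  coefficient of the interpolant, the one of \<open>z\<^sup>3\<^sup>k\<close>, has denominator at most \<open>C\<^sup>k\<close>; for a suitable
  choice of the distinguished node it is nonzero. On the other hand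
  \<open>w\<^sub>j r\<^sub>j s\<^sub>j (N + a\<^sub>j)\<^sup>-\<^sup>1\<^sup>/\<^sup>2 = (M + a\<^sub>j)\<^sup>1\<^sup>/\<^sup>2\<close> is close to \<open>M\<^sup>1\<^sup>/\<^sup>2\<close> for all \<open>j\<close>, so the interpolated function is
  close to \<open>M\<^sup>1\<^sup>/\<^sup>2 (N + z)\<^sup>k\<^sup>+\<^sup>1\<^sup>/\<^sup>2\<close>, hence to a Taylor polynomial of degree less than \<open>3 k\<close>. Comparing,
  \<open>1 \<le> C\<^sup>k (N\<^sup>k\<^sup>+\<^sup>1\<^sup>/\<^sup>2 M\<^sup>-\<^sup>1\<^sup>/\<^sup>2 + M\<^sup>1\<^sup>/\<^sup>2 N\<^sup>1\<^sup>/\<^sup>2\<^sup>-\<^sup>2\<^sup>k)\<close> for all \<open>k > 0\<close>, which fails when \<open>M\<^sup>1\<^sup>/\<^sup>2\<close> is roughly between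
  \<open>N\<^sup>k\<close> and \<open>N\<^sup>2\<^sup>k\<close>.
\<close>

subsection \<open>Hermite interpolation\<close>

lemma linear_power_dvd_of_coeff_pcompose:
  fixes f :: "'a :: field poly"
  assumes "\<And>h. h < m \<Longrightarrow> coeff (f \<circ>\<^sub>p [:a, 1:]) h = 0"
  shows "[:-a, 1:] ^ m dvd f"
proof -
  have "monom 1 m dvd f \<circ>\<^sub>p [:a, 1:]"
    using assms by (simp add: monom_1_dvd_iff')
  then obtain g where g: "f \<circ>\<^sub>p [:a, 1:] = [:0, 1:] ^ m * g"
    by (metis dvd_def monom_altdef smult_1_left)
  have "[:0, 1:] ^ m \<circ>\<^sub>p [:-a, 1:] = [:-a, 1 :: 'a:] ^ m"
    by (induction m) (simp_all add: pcompose_mult pcompose_pCons pcompose_1)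
  moreover have "f = (f \<circ>\<^sub>p [:a, 1:]) \<circ>\<^sub>p [:-a, 1:]"
    by (simp add: pcompose_assoc [symmetric] pcompose_pCons)
  ultimately show ?thesis
    unfolding g by (metis dvd_triv_left pcompose_mult)
qed

text \<open>The data are Taylor coefficients at the nodes rather than derivatives, so no factorials
  enter the denominators.\<close>

definition hermite_interpolates ::
    "'i set \<Rightarrow> ('i \<Rightarrow> real) \<Rightarrow> ('i \<Rightarrow> nat) \<Rightarrow> ('i \<Rightarrow> nat \<Rightarrow> real) \<Rightarrow> real poly \<Rightarrow> bool"
  where "hermite_interpolates I a \<kappa> \<phi> f \<longleftrightarrow>
    (\<forall>i\<in>I. \<forall>h<\<kappa> i. coeff (f \<circ>\<^sub>p [:a i, 1:]) h = \<phi> i h)"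

text \<open>Vanishing to order \<open>\<kappa> i\<close> at each node makes \<open>f\<close> a
  multiple of pairwise coprime powers, whose product already has degree
  \<open>sum \<kappa> I\<close>.\<close>

lemma hermite_zero_imp_zero:
  assumes "finite I" "inj_on a I"
    and "hermite_interpolates I a \<kappa> (\<lambda>_ _. 0) f"
    and "degree f < sum \<kappa> I"
  shows "f = 0"
proof (rule ccontr)
  assume "f \<noteq> 0"
  let ?g = "\<lambda>i. [:-a i, 1:] ^ \<kappa> i"
  have dvd: "?g i dvd f" if "i \<in> I" for i
    using assms(3) that
    by (intro linear_power_dvd_of_coeff_pcompose) (auto simp: hermite_interpolates_def)
  have cop: "coprime (?g i) (?g j)" if "i \<in> I" "j \<in> I" "i \<noteq> j" for i j
  proof -
    have "a i \<noteq> a j" using that assms(2) by (auto dest: inj_onD)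
    then have "coprime [:-a i, 1:] [:-a j, 1:]"
    proof (intro coprimeI)
      fix c assume ne: "a i \<noteq> a j" and "c dvd [:-a i, 1:]" "c dvd [:-a j, 1:]"
      then have "c dvd [:-a i, 1:] - [:-a j, 1:]" by (rule_tac dvd_diff)
      then have "c dvd [:a j - a i:]" by simp
      moreover have "is_unit [:a j - a i:]" using ne by (simp add: is_unit_const_poly_iff dvd_field_iff)
      ultimately show "is_unit c" by (rule dvd_trans)
    qed
    then show ?thesis by simp
  qed
  have "prod ?g J dvd f" if "J \<subseteq> I" for J
    using finite_subset [OF that assms(1)] that
  proof (induction J)
    case empty
    then show ?case by simp
  next
    case (insert i J)
    then have "coprime (?g i) (prod ?g J)"
      by (intro prod_coprime_right cop) auto
    with insert dvd show ?case
      by (simp add: divides_mult)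
  qed
  then have "degree (prod ?g I) \<le> degree f"
    using \<open>f \<noteq> 0\<close> by (intro dvd_imp_degree_le) auto
  moreover have "degree (prod ?g I) = sum \<kappa> I"
    by (subst degree_prod_eq_sum_degree) (auto simp: degree_linear_power)
  ultimately show False using assms(4) by simp
qed

lemma hermite_unique:
  assumes "finite I" "inj_on a I"
    and "hermite_interpolates I a \<kappa> \<phi> f" "hermite_interpolates I a \<kappa> \<phi> g"
    and "degree f < sum \<kappa> I" "degree g < sum \<kappa> I"
  shows "f = g"
proof -
  have "f - g = 0"
  proof (rule hermite_zero_imp_zero [OF assms(1,2)])
    show "hermite_interpolates I a \<kappa> (\<lambda>_ _. 0) (f - g)"
      using assms(3,4) by (simp add: hermite_interpolates_def pcompose_diff)
    show "degree (f - g) < sum \<kappa> I"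
      using assms(5,6) by (meson degree_diff_less)
  qed
  then show ?thesis by simp
qed

lemma coeff_linear_mult:
  "coeff ([:b, 1 :: real:] * p) h = b * coeff p h + (if h = 0 then 0 else coeff p (h - 1))"
  by (cases h) auto

text \<open>The coefficient at \<open>sum \<kappa> I - 1\<close> is the divided difference of the
  data, with repeated nodes. Its size and its denominator are tracked through a recursion on the
  number of conditions: each step costs a factor 2 in size and a factor \<open>D\<close> in the
  denominator.\<close>

lemma hermite_exists:
  fixes a :: "'i \<Rightarrow> int" and D :: int
  assumes "finite I" "inj_on a I" "sum \<kappa> I > 0"
    and D: "\<And>i j. i \<in> I \<Longrightarrow> j \<in> I \<Longrightarrow> i \<noteq> j \<Longrightarrow> (a i - a j) dvd D"
  shows "\<exists>f. degree f < sum \<kappa> I \<and> hermite_interpolates I (\<lambda>i. real_of_int (a i)) \<kappa> \<phi> f \<and>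
    (\<forall>B. (\<forall>i\<in>I. \<forall>h<\<kappa> i. \<bar>\<phi> i h\<bar> \<le> B) \<longrightarrow>
      \<bar>coeff f (sum \<kappa> I - 1)\<bar> \<le> 2 ^ (sum \<kappa> I - 1) * B) \<and>
    (\<forall>L. (\<forall>i\<in>I. \<forall>h<\<kappa> i. L * \<phi> i h \<in> \<int>) \<longrightarrow>
      L * real_of_int D ^ (sum \<kappa> I - 1) * coeff f (sum \<kappa> I - 1) \<in> \<int>)"
  using assms(3)
proof (induction "sum \<kappa> I" arbitrary: \<kappa> rule: less_induct)
  case less
  let ?a = "\<lambda>i. real_of_int (a i)"
  obtain i where i: "i \<in> I" "\<kappa> i > 0"
  proof -
    have "sum \<kappa> I \<noteq> 0" using less.prems by simp
    then obtain i where "i \<in> I" "\<kappa> i \<noteq> 0" by (rule sum.not_neutral_contains_not_neutral)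
    with that show ?thesis by simp
  qed
  show ?case
  proof (cases "\<exists>j\<in>I. j \<noteq> i \<and> \<kappa> j > 0")
    case False
    then have n: "sum \<kappa> I = \<kappa> i"
      using i assms(1) by (subst sum.remove [of _ i]) auto
    \<comment> \<open>Only the node \<open>i\<close> carries conditions, so a Taylor polynomial at
      \<open>a i\<close> does it, and the tracked coefficient is the last datum.\<close>
    define F where "F = (\<Sum>h<\<kappa> i. monom (\<phi> i h) h)"
    define f where "f = F \<circ>\<^sub>p [:- ?a i, 1:]"
    have cF: "coeff F h = (if h < \<kappa> i then \<phi> i h else 0)" for h
      by (simp add: F_def coeff_sum)
    have F: "f \<circ>\<^sub>p [:?a i, 1:] = F"
      unfolding f_def by (simp add: pcompose_assoc [symmetric] pcompose_pCons)
    have degf: "degree f = degree F"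
      unfolding f_def by (simp add: degree_pcompose)
    have degF: "degree F < \<kappa> i"
    proof -
      have "degree F \<le> \<kappa> i - 1" by (intro degree_le) (auto simp: cF)
      with i(2) show ?thesis by simp
    qed
    have "coeff f (\<kappa> i - 1) = coeff F (\<kappa> i - 1)"
    proof (cases "degree F = \<kappa> i - 1")
      case True
      have "lead_coeff f = lead_coeff F"
        unfolding f_def by (subst lead_coeff_comp) auto
      with True degf show ?thesis by simp
    next
      case False
      with degF have "degree F < \<kappa> i - 1" by simp
      with degf show ?thesis by (simp add: coeff_eq_0)
    qed
    then have lc: "coeff f (sum \<kappa> I - 1) = \<phi> i (\<kappa> i - 1)"
      using i n by (simp add: cF)
    show ?thesis
    proof (intro exI [of _ f] conjI allI impI)
      show "degree f < sum \<kappa> I" using degf degF n by simp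
      show "hermite_interpolates I ?a \<kappa> \<phi> f"
        unfolding hermite_interpolates_def using False F cF by auto
    next
      fix B assume B: "\<forall>i\<in>I. \<forall>h<\<kappa> i. \<bar>\<phi> i h\<bar> \<le> B"
      then have *: "\<bar>\<phi> i (\<kappa> i - 1)\<bar> \<le> B" using i by simp
      moreover from * have "B \<ge> 0" by linarith
      then have "1 * B \<le> 2 ^ (sum \<kappa> I - 1) * B"
        by (intro mult_right_mono) auto
      ultimately show "\<bar>coeff f (sum \<kappa> I - 1)\<bar> \<le> 2 ^ (sum \<kappa> I - 1) * B"
        using lc by simp
    next
      fix L assume "\<forall>i\<in>I. \<forall>h<\<kappa> i. L * \<phi> i h \<in> \<int>"
      then have "L * \<phi> i (\<kappa> i - 1) \<in> \<int>" using i by simp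
      then have "(real_of_int D ^ (sum \<kappa> I - 1)) * (L * \<phi> i (\<kappa> i - 1)) \<in> \<int>"
        by (rule Ints_mult [OF Ints_power [OF Ints_of_int]])
      then show "L * real_of_int D ^ (sum \<kappa> I - 1) * coeff f (sum \<kappa> I - 1) \<in> \<int>"
        by (simp only: lc mult_ac)
    qed
  next
    case True
    then obtain j where j: "j \<in> I" "j \<noteq> i" "\<kappa> j > 0" by blast
    define n where "n = sum \<kappa> I"
    have split: "n = \<kappa> i + \<kappa> j + sum \<kappa> (I - {i} - {j})"
      unfolding n_def using i j assms(1)
      by (subst sum.remove [of _ i], simp, simp, subst sum.remove [of _ j]) auto
    let ?\<kappa>i = "\<kappa>(i := \<kappa> i - 1)" and ?\<kappa>j = "\<kappa>(j := \<kappa> j - 1)"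
    have rest: "sum ?\<kappa>i (I - {i} - {j}) = sum \<kappa> (I - {i} - {j})"
      "sum ?\<kappa>j (I - {i} - {j}) = sum \<kappa> (I - {i} - {j})"
      by (auto intro!: sum.cong)
    have ni: "sum ?\<kappa>i I = n - 1"
      using i j assms(1) split rest
      by (subst sum.remove [of _ i], simp, simp, subst sum.remove [of _ j]) auto
    have nj: "sum ?\<kappa>j I = n - 1"
      using i j assms(1) split rest
      by (subst sum.remove [of _ i], simp, simp, subst sum.remove [of _ j]) auto
    have n2: "n \<ge> 2" using split i j by simp
    have m1: "n - 1 - 1 = n - 2" by simp
    have m2: "n - 1 = Suc (n - 2)" using n2 by simp
    obtain fi where fi: "degree fi < n - 1" "hermite_interpolates I ?a ?\<kappa>i \<phi> fi"
      "\<And>B. (\<forall>l\<in>I. \<forall>h<?\<kappa>i l. \<bar>\<phi> l h\<bar> \<le> B) \<Longrightarrow> \<bar>coeff fi (n - 2)\<bar> \<le> 2 ^ (n - 2) * B"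
      "\<And>L. (\<forall>l\<in>I. \<forall>h<?\<kappa>i l. L * \<phi> l h \<in> \<int>) \<Longrightarrow> L * real_of_int D ^ (n - 2) * coeff fi (n - 2) \<in> \<int>"
      using less.hyps [of ?\<kappa>i] n2 unfolding ni n_def [symmetric] m1
      by (elim meta_impE) (simp, simp, blast)
    obtain fj where fj: "degree fj < n - 1" "hermite_interpolates I ?a ?\<kappa>j \<phi> fj"
      "\<And>B. (\<forall>l\<in>I. \<forall>h<?\<kappa>j l. \<bar>\<phi> l h\<bar> \<le> B) \<Longrightarrow> \<bar>coeff fj (n - 2)\<bar> \<le> 2 ^ (n - 2) * B"
      "\<And>L. (\<forall>l\<in>I. \<forall>h<?\<kappa>j l. L * \<phi> l h \<in> \<int>) \<Longrightarrow> L * real_of_int D ^ (n - 2) * coeff fj (n - 2) \<in> \<int>"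
      using less.hyps [of ?\<kappa>j] n2 unfolding nj n_def [symmetric] m1
      by (elim meta_impE) (simp, simp, blast)
    define d where "d = a j - a i"
    have d0: "d \<noteq> 0" using inj_onD [OF assms(2)] i j unfolding d_def by auto
    \<comment> \<open>Neville's recursion; each step costs one division by a difference of nodes.\<close>
    define f where "f = smult (1 / d) ([:- ?a i, 1:] * fi - [:- ?a j, 1:] * fj)"
    have degf: "degree f < n"
    proof -
      have "degree ([:- ?a i, 1:] * fi) \<le> degree [:- ?a i, 1:] + degree fi"
        "degree ([:- ?a j, 1:] * fj) \<le> degree [:- ?a j, 1:] + degree fj"
        by (rule degree_mult_le)+
      then have "degree ([:- ?a i, 1:] * fi - [:- ?a j, 1:] * fj) < n"
        using fi(1) fj(1) by (intro degree_diff_less) auto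
      then show ?thesis unfolding f_def
        using degree_smult_le le_less_trans by blast
    qed
    have coeff_f: "coeff (f \<circ>\<^sub>p [:?a l, 1:]) h = \<phi> l h" if l: "l \<in> I" "h < \<kappa> l" for l h
    proof -
      let ?Fi = "fi \<circ>\<^sub>p [:?a l, 1:]" and ?Fj = "fj \<circ>\<^sub>p [:?a l, 1:]"
      have "f \<circ>\<^sub>p [:?a l, 1:] =
          smult (1 / d) ([:?a l - ?a i, 1:] * ?Fi - [:?a l - ?a j, 1:] * ?Fj)"
        unfolding f_def
        by (simp only: pcompose_smult pcompose_diff pcompose_mult) (simp add: pcompose_pCons)
      moreover have Fi: "coeff ?Fi h' = \<phi> l h'" if "h' < ?\<kappa>i l" for h'
        using fi(2) l that unfolding hermite_interpolates_def by auto
      moreover have Fj: "coeff ?Fj h' = \<phi> l h'" if "h' < ?\<kappa>j l" for h'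
        using fj(2) l that unfolding hermite_interpolates_def by auto
      have "coeff ([:?a l - ?a i, 1:] * ?Fi) h - coeff ([:?a l - ?a j, 1:] * ?Fj) h
        = (?a j - ?a i) * \<phi> l h"
      proof -
        \<comment> \<open>If \<open>l = i\<close>, then \<open>h\<close> may be the index dropped
          for \<open>fi\<close>, but in that case the linear factor is zero; \<open>B\<close> is the
          same for \<open>j\<close>.\<close>
        have A: "(?a l - ?a i) * coeff ?Fi h = (?a l - ?a i) * \<phi> l h"
          using Fi [of h] l by (cases "l = i") auto
        have B: "(?a l - ?a j) * coeff ?Fj h = (?a l - ?a j) * \<phi> l h"
          using Fj [of h] l by (cases "l = j") auto
        \<comment> \<open>Both interpolants retain index \<open>h - 1\<close>, so the contributions
          of the leading 1 of the linear factors cancel.\<close>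
        have C: "coeff ?Fi (h - 1) = coeff ?Fj (h - 1)" if "h > 0"
        proof -
          have "h - 1 < ?\<kappa>i l" "h - 1 < ?\<kappa>j l" using l that by auto
          then show ?thesis using Fi Fj by metis
        qed
        show ?thesis unfolding coeff_linear_mult A B using C
          by (cases "h = 0") (auto simp: algebra_simps)
      qed
      ultimately show ?thesis using d0 by (simp add: d_def)
    qed
    have lc: "coeff f (n - 1) = (coeff fi (n - 2) - coeff fj (n - 2)) / d"
    proof -
      have "coeff fi (n - 1) = 0" "coeff fj (n - 1) = 0"
        using fi(1) fj(1) by (simp_all add: coeff_eq_0)
      moreover have "n - 1 - 1 = n - 2" "n - 1 \<noteq> 0" using n2 by auto
      ultimately show ?thesis
        unfolding f_def coeff_smult coeff_diff coeff_linear_mult by simp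
    qed
    have mono: "h < \<kappa> l" if "h < ?\<kappa>i l \<or> h < ?\<kappa>j l" for l h
      using that by (auto split: if_splits)
    show ?thesis unfolding n_def [symmetric]
    proof (intro exI [of _ f] conjI allI impI)
      show "degree f < n" by (rule degf)
      show "hermite_interpolates I ?a \<kappa> \<phi> f"
        unfolding hermite_interpolates_def using coeff_f by blast
    next
      fix B assume B: "\<forall>i\<in>I. \<forall>h<\<kappa> i. \<bar>\<phi> i h\<bar> \<le> B"
      have "\<bar>coeff fi (n - 2)\<bar> \<le> 2 ^ (n - 2) * B" "\<bar>coeff fj (n - 2)\<bar> \<le> 2 ^ (n - 2) * B"
        using B mono by (blast intro: fi(3) fj(3))+
      moreover have "\<bar>coeff f (n - 1)\<bar> \<le> \<bar>coeff fi (n - 2) - coeff fj (n - 2)\<bar>"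
      proof -
        \<comment> \<open>Distinct integer nodes are at distance at least 1, so the division does
          not enlarge the bound.\<close>
        have "\<bar>real_of_int d\<bar> \<ge> 1" using d0 by linarith
        then show ?thesis unfolding lc abs_divide
          by (smt (verit) divide_le_eq_1 abs_ge_zero divide_right_mono div_by_1 frac_le)
      qed
      moreover have "(2 :: real) ^ (n - 1) = 2 * 2 ^ (n - 2)"
        unfolding m2 by simp
      ultimately show "\<bar>coeff f (n - 1)\<bar> \<le> 2 ^ (n - 1) * B"
        by (simp only: mult.assoc) linarith
    next
      fix L assume L: "\<forall>i\<in>I. \<forall>h<\<kappa> i. L * \<phi> i h \<in> \<int>"
      have "L * real_of_int D ^ (n - 2) * coeff fi (n - 2) \<in> \<int>" "L * real_of_int D ^ (n - 2) * coeff fj (n - 2) \<in> \<int>"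
        using L mono by (blast intro: fi(4) fj(4))+
      then have *: "L * real_of_int D ^ (n - 2) * coeff fi (n - 2) - L * real_of_int D ^ (n - 2) * coeff fj (n - 2) \<in> \<int>"
        by (rule Ints_diff)
      obtain c where c: "D = d * c" using D [of j i] i j by (auto simp: d_def)
      have "real_of_int D ^ (n - 1) = real_of_int D ^ (n - 2) * (real_of_int d * real_of_int c)"
        unfolding m2 power_Suc2 c by simp
      then have "L * real_of_int D ^ (n - 1) * coeff f (n - 1)
          = real_of_int c * (L * real_of_int D ^ (n - 2) * coeff fi (n - 2) - L * real_of_int D ^ (n - 2) * coeff fj (n - 2))"
        unfolding lc using d0 by (simp add: field_simps)
      with * show "L * real_of_int D ^ (n - 1) * coeff f (n - 1) \<in> \<int>"
        by (auto intro: Ints_mult)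
    qed
  qed
qed

text \<open>
  The hypothesis on \<open>\<phi>\<close> says that the data satisfy the differential equation
  \<open>(x + z) f' = s f\<close> of \<open>(x + z) powr s\<close>, with a separate constant factor at each node. If all
  the leading coefficients vanish, the interpolants coincide with one polynomial of degree less
  than \<open>card I * k\<close>; by counting zeros it satisfies the equation identically, which is impossible
  for \<open>s \<notin> \<nat>\<close>.
\<close>
lemma hermite_leading_coeff_nonzero:
  fixes x s :: real
  assumes "finite I" "inj_on a I" "I \<noteq> {}" "k > 0" and s: "s \<notin> \<nat>"
    and \<phi>: "\<And>i h. i \<in> I \<Longrightarrow> h < k \<Longrightarrow>
      (x + a i) * (real (Suc h) * \<phi> i (Suc h)) = (s - real h) * \<phi> i h"
    and nz: "i0 \<in> I" "\<phi> i0 0 \<noteq> 0"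
    and f: "\<And>e. e \<in> I \<Longrightarrow> hermite_interpolates I a ((\<lambda>_. k)(e := Suc k)) \<phi> (f e)"
    and deg: "\<And>e. e \<in> I \<Longrightarrow> degree (f e) < Suc (card I * k)"
  shows "\<exists>e\<in>I. coeff (f e) (card I * k) \<noteq> 0"
proof (rule ccontr)
  assume "\<not> ?thesis"
  then have c0: "coeff (f e) (card I * k) = 0" if "e \<in> I" for e using that by simp
  have n0: "card I * k > 0" using assms(1,3,4) by (simp add: card_gt_0_iff)
  have deg': "degree (f e) < card I * k" if "e \<in> I" for e
  proof -
    have "degree (f e) \<noteq> card I * k"
      using c0 [OF that] n0 by (metis degree_0 leading_coeff_0_iff less_irrefl)
    with deg [OF that] show ?thesis by simp
  qed
  have fk: "hermite_interpolates I a (\<lambda>_. k) \<phi> (f e)" if "e \<in> I" for e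
    using f [OF that] by (auto simp: hermite_interpolates_def split: if_splits)
  define g where "g = f i0"
  have eq: "f e = g" if "e \<in> I" for e
    unfolding g_def using that nz(1) deg'
    by (intro hermite_unique [OF assms(1,2) fk fk]) auto
  \<comment> \<open>Every node is the distinguished one for some \<open>f e\<close>, and all
    \<open>f e\<close> equal \<open>g\<close>; hence index \<open>k\<close> is matched at all nodes.
    This extra coefficient makes \<open>q\<close> below vanish to order \<open>k\<close>, since
    differentiation shifts the index by one.\<close>
  have g: "coeff (g \<circ>\<^sub>p [:a i, 1:]) h = \<phi> i h" if "i \<in> I" "h \<le> k" for i h
    using f [OF that(1)] that unfolding eq [OF that(1)] hermite_interpolates_def by auto
  define q where "q = [:x, 1:] * pderiv g - smult s g"
  have "q = 0"
  proof (rule hermite_zero_imp_zero [OF assms(1,2)])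
    show "hermite_interpolates I a (\<lambda>_. k) (\<lambda>_ _. 0) q"
      unfolding hermite_interpolates_def
    proof (intro ballI allI impI)
      fix i h assume ih: "i \<in> I" "h < k"
      let ?G = "g \<circ>\<^sub>p [:a i, 1:]"
      have "pderiv ?G = pderiv g \<circ>\<^sub>p [:a i, 1:]"
        by (simp add: pderiv_pcompose pderiv_pCons)
      then have "q \<circ>\<^sub>p [:a i, 1:] = [:x + a i, 1:] * pderiv ?G - smult s ?G"
        unfolding q_def
        by (simp only: pcompose_smult pcompose_diff pcompose_mult) (simp add: pcompose_pCons)
      then have "coeff (q \<circ>\<^sub>p [:a i, 1:]) h =
          (x + a i) * (real (Suc h) * coeff ?G (Suc h)) + real h * coeff ?G h - s * coeff ?G h"
        by (simp only: coeff_diff coeff_smult coeff_linear_mult coeff_pderiv) (cases h, auto)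
      with g ih \<phi> [OF ih] show "coeff (q \<circ>\<^sub>p [:a i, 1:]) h = 0"
        by (simp only:) (simp add: algebra_simps)
    qed
    have "degree ([:x, 1:] * pderiv g) \<le> degree [:x, 1:] + degree (pderiv g)"
      by (rule degree_mult_le)
    moreover have "degree g < card I * k" unfolding g_def using deg' nz(1) by simp
    ultimately have "degree ([:x, 1:] * pderiv g) < card I * k"
    proof (cases "degree g = 0")
      case True
      then have "pderiv g = 0" by (simp add: pderiv_eq_0_iff)
      with n0 show ?thesis by simp
    qed (use n0 in \<open>simp add: degree_pderiv\<close>)
    then have "degree q < card I * k"
      unfolding q_def using \<open>degree g < _\<close> n0
      by (intro degree_diff_less) (auto intro: le_less_trans [OF degree_smult_le])
    then show "degree q < sum (\<lambda>_. k) I" by simp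
  qed
  then have "coeff q (degree g) = 0" by simp
  moreover have "coeff q (degree g) = (real (degree g) - s) * lead_coeff g"
    unfolding q_def coeff_diff coeff_smult coeff_linear_mult coeff_pderiv
    by (cases "degree g") (auto simp: algebra_simps coeff_eq_0)
  ultimately have "g = 0" using s by (auto simp: Nats_def)
  then show False using g [OF nz(1), of 0] nz(2) by simp
qed

subsection \<open>Binomial series with half-integral exponent\<close>

text \<open>These are the coefficients of \<open>(1 - 4 z) powr (-1/2)\<close>, the generating
  function of the central binomial coefficients; both sides obey the same one-step
  recursion.\<close>

lemma gbinomial_minus_half:
  "(-1/2 gchoose h) * (-4) ^ h = (of_nat ((2 * h) choose h) :: real)"
proof (induction h)
  case (Suc h)
  have "real (Suc h) * real ((2 * Suc h) choose Suc h) = 2 * real (2 * h + 1) * real ((2 * h) choose h)"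
  proof -
    have "2 * Suc h - Suc h = Suc h" "2 * Suc h = Suc (Suc (2 * h))" "2 * h - h = h" by simp_all
    then have "real ((2 * Suc h) choose Suc h) = fact (Suc (Suc (2 * h))) / (fact (Suc h) * fact (Suc h))"
      "real ((2 * h) choose h) = fact (2 * h) / (fact h * fact h)"
      using binomial_fact [of "Suc h" "2 * Suc h", where ?'a = real]
        binomial_fact [of h "2 * h", where ?'a = real] by simp_all
    then show ?thesis
      by (simp only: fact_Suc) (simp add: divide_simps del: binomial_Suc_Suc, simp add: algebra_simps)
  qed
  moreover have "real (Suc h) * ((-1/2) gchoose (Suc h)) = (-1/2 - real h) * ((-1/2) gchoose h)"
    using gbinomial_absorb_comp [of "-1/2 :: real" h] gbinomial_absorption [of h "-1/2 :: real"] by simp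
  then have "(real (Suc h) * ((-1/2) gchoose (Suc h))) * (-4) ^ Suc h
      = 2 * real (2 * h + 1) * (((-1/2) gchoose h) * (-4) ^ h)"
    by (simp only:) (simp add: algebra_simps)
  then have "real (Suc h) * (((-1/2) gchoose (Suc h)) * (-4) ^ Suc h)
      = 2 * real (2 * h + 1) * (((-1/2) gchoose h) * (-4) ^ h)"
    by (simp only: mult.assoc)
  ultimately have "real (Suc h) * (((-1/2) gchoose (Suc h)) * (-4) ^ Suc h)
      = real (Suc h) * real ((2 * Suc h) choose Suc h)"
    using Suc.IH by simp
  then show ?case by (simp only: mult_cancel_left of_nat_eq_0_iff) simp
qed simp

text \<open>Exponent \<open>-1/2\<close> is the central binomial case; Pascal's rule then raises the
  exponent by 1 without new denominators.\<close>

lemma gbinomial_half_integral: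
  "4 ^ h * ((real k - 1/2) gchoose h) \<in> \<int>"
proof (induction k arbitrary: h)
  case 0
  have "4 ^ h * ((-1/2 :: real) gchoose h) = (-1) ^ h * of_nat ((2 * h) choose h)"
    unfolding gbinomial_minus_half [symmetric] by (simp flip: power_mult_distrib)
  then show ?case by (simp add: Ints_mult)
next
  case (Suc k)
  show ?case
  proof (cases h)
    case (Suc m)
    have "real (Suc k) - 1/2 = (real k - 1/2) + 1" by simp
    then have "4 ^ h * ((real (Suc k) - 1/2) gchoose h)
        = 4 * (4 ^ m * ((real k - 1/2) gchoose m)) + 4 ^ Suc m * ((real k - 1/2) gchoose Suc m)"
      unfolding Suc by (simp only: gbinomial_Suc_Suc) (simp add: algebra_simps)
    with Suc.IH [of m] Suc.IH [of "Suc m"] show ?thesis by (simp only: Ints_add Ints_mult Ints_numeral)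
  qed simp
qed

text \<open>At exponent \<open>-1/2\<close> the ratio of consecutive coefficients has absolute value
  at most 1, and each use of Pascal's rule at most doubles the bound. What matters is uniformity in
  \<open>h\<close>.\<close>

lemma abs_gbinomial_half_le:
  "\<bar>(real k - 1/2) gchoose h\<bar> \<le> 2 ^ k"
proof (induction k arbitrary: h)
  case 0
  have "\<bar>(-1/2 :: real) gchoose h\<bar> \<le> 1" for h
  proof (induction h)
    case (Suc h)
    have "real (Suc h) * ((-1/2) gchoose (Suc h)) = (-1/2 - real h) * ((-1/2) gchoose h)"
      using gbinomial_absorb_comp [of "-1/2 :: real" h] gbinomial_absorption [of h "-1/2 :: real"] by simp
    then have "(-1/2) gchoose (Suc h) = ((-1/2 - real h) / real (Suc h)) * ((-1/2) gchoose h)"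
      by (simp add: field_simps)
    moreover have "\<bar>((-1/2 - real h) / real (Suc h))\<bar> \<le> 1" by (simp add: abs_le_iff field_simps)
    ultimately show ?case using Suc by (simp only: abs_mult mult_le_one abs_ge_zero)
  qed simp
  then show ?case by simp
next
  case (Suc k)
  show ?case
  proof (cases h)
    case 0
    have "(1 :: real) \<le> 2 * 2 ^ k" using one_le_power [of "2 :: real" "Suc k"] by simp
    then show ?thesis using 0 by simp
  next
    case (Suc m)
    have "real (Suc k) - 1/2 = (real k - 1/2) + 1" by simp
    then have "(real (Suc k) - 1/2) gchoose h
        = ((real k - 1/2) gchoose m) + ((real k - 1/2) gchoose Suc m)"
      unfolding Suc by (simp only: gbinomial_Suc_Suc)
    with Suc.IH [of m] Suc.IH [of "Suc m"] show ?thesis by simp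
  qed
qed

section \<open>Taylor polynomials of real powers\<close>

lemma powr_taylor:
  fixes N x t :: real
  assumes "\<bar>x\<bar> < N"
  shows "\<exists>\<xi>. \<bar>\<xi>\<bar> \<le> \<bar>x\<bar> \<and> (N + x) powr t =
    (\<Sum>m<n. (t gchoose m) * N powr (t - real m) * x ^ m) + (t gchoose n) * (N + \<xi>) powr (t - real n) * x ^ n"
proof -
  define diff where "diff m y = fact m * (t gchoose m) * (N + y) powr (t - real m)" for m y
  have "\<exists>\<xi>. \<bar>\<xi>\<bar> \<le> \<bar>x\<bar> \<and> (N + x) powr t =
      (\<Sum>m<n. diff m 0 / fact m * x ^ m) + diff n \<xi> / fact n * x ^ n"
  proof (rule Maclaurin_bi_le)
    show "diff 0 = (\<lambda>y. (N + y) powr t)" by (rule ext) (simp add: diff_def)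
    show "\<forall>m y. m < n \<and> \<bar>y\<bar> \<le> \<bar>x\<bar> \<longrightarrow> DERIV (diff m) y :> diff (Suc m) y"
    proof (intro allI impI)
      fix m y assume "m < n \<and> \<bar>y\<bar> \<le> \<bar>x\<bar>"
      then have pos: "N + y > 0" using assms by linarith
      have *: "fact (Suc m) * (t gchoose Suc m) = fact m * (t gchoose m) * (t - real m)"
        by (simp only: gbinomial_mult_fact) simp
      have e: "t - real (Suc m) = t - real m - 1" by simp
      show "DERIV (diff m) y :> diff (Suc m) y"
        unfolding diff_def * e using pos
        by (auto intro!: derivative_eq_intros)
    qed
  qed
  then show ?thesis by (simp add: diff_def)
qed

lemma coeff_pcompose_monom_shift:
  fixes a c :: real
  shows "coeff (monom c m \<circ>\<^sub>p [:a, 1:]) h = c * real (m choose h) * a ^ (m - h)"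
proof -
  have "monom c m \<circ>\<^sub>p [:a, 1:] = smult c ([:a, 1:] ^ m)"
    by (induction m) (simp_all add: monom_0 monom_Suc pcompose_pCons)
  then show ?thesis
    by (cases "h \<le> m") (simp_all add: coeff_linear_poly_power coeff_eq_0 degree_linear_power)
qed

text \<open>By trinomial revision, coefficient \<open>h\<close> of \<open>p n\<close> re-expanded at
  \<open>a\<close> is \<open>s gchoose h\<close> times the Taylor sum of
  \<open>(N + a) powr (s - h)\<close> with \<open>n - h\<close> terms. A single Lagrange remainder
  therefore gives the whole error.\<close>

lemma powr_taylor_poly:
  fixes N s a :: real
  defines "p n \<equiv> (\<Sum>m<n. monom ((s gchoose m) * N powr (s - real m)) m)"
  assumes "\<bar>a\<bar> < N" "h \<le> n"
  shows "\<exists>\<xi>. \<bar>\<xi>\<bar> \<le> \<bar>a\<bar> \<and> (s gchoose h) * (N + a) powr (s - real h) - coeff (p n \<circ>\<^sub>p [:a, 1:]) h =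
    (s gchoose n) * real (n choose h) * (N + \<xi>) powr (s - real n) * a ^ (n - h)"
proof -
  have tri: "(s gchoose (i + h)) * real ((i + h) choose h) = (s gchoose h) * ((s - real h) gchoose i)" for i
    using gbinomial_trinomial_revision [of h "i + h" s] by (simp add: binomial_gbinomial)
  obtain \<xi> where \<xi>: "\<bar>\<xi>\<bar> \<le> \<bar>a\<bar>" "(N + a) powr (s - real h) =
    (\<Sum>m<n - h. ((s - real h) gchoose m) * N powr (s - real h - real m) * a ^ m)
    + ((s - real h) gchoose (n - h)) * (N + \<xi>) powr (s - real h - real (n - h)) * a ^ (n - h)"
    using powr_taylor [OF assms(2)] by blast
  have "coeff (p n \<circ>\<^sub>p [:a, 1:]) h =
      (\<Sum>m<n. (s gchoose m) * N powr (s - real m) * real (m choose h) * a ^ (m - h))"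
    unfolding p_def by (simp add: pcompose_sum coeff_sum coeff_pcompose_monom_shift)
  also have "\<dots> = (\<Sum>m\<in>{h..<n}. (s gchoose m) * N powr (s - real m) * real (m choose h) * a ^ (m - h))"
    by (rule sum.mono_neutral_right) auto
  also have "\<dots> = (\<Sum>i<n - h. (s gchoose (i + h)) * N powr (s - real (i + h)) * real ((i + h) choose h) * a ^ i)"
    using assms(3) by (intro sum.reindex_bij_witness [of _ "\<lambda>i. i + h" "\<lambda>m. m - h"]) auto
  also have "\<dots> = (\<Sum>i<n - h. (s gchoose h) * (((s - real h) gchoose i) * N powr (s - real h - real i) * a ^ i))"
  proof (rule sum.cong [OF refl])
    fix i
    have "(s gchoose (i + h)) * N powr (s - real (i + h)) * real ((i + h) choose h) * a ^ i
      = ((s gchoose (i + h)) * real ((i + h) choose h)) * N powr (s - real (i + h)) * a ^ i"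
      by (simp only: mult_ac)
    then show "(s gchoose (i + h)) * N powr (s - real (i + h)) * real ((i + h) choose h) * a ^ i
      = (s gchoose h) * (((s - real h) gchoose i) * N powr (s - real h - real i) * a ^ i)"
      unfolding tri by (simp add: algebra_simps)
  qed
  finally have "coeff (p n \<circ>\<^sub>p [:a, 1:]) h =
    (s gchoose h) * (\<Sum>i<n - h. ((s - real h) gchoose i) * N powr (s - real h - real i) * a ^ i)"
    by (simp only: sum_distrib_left)
  then have "(s gchoose h) * (N + a) powr (s - real h) - coeff (p n \<circ>\<^sub>p [:a, 1:]) h =
     (s gchoose h) * (((s - real h) gchoose (n - h)) * (N + \<xi>) powr (s - real h - real (n - h)) * a ^ (n - h))"
    unfolding \<xi>(2) by (simp only:) (simp add: algebra_simps)
  also have "\<dots> = (s gchoose n) * real (n choose h) * (N + \<xi>) powr (s - real n) * a ^ (n - h)"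
    using tri [of "n - h"] assms(3) by (simp add: of_nat_diff)
  finally show ?thesis using \<xi>(1) by blast
qed

lemma abs_sqrt_add_diff_le:
  fixes M a :: real
  assumes "M > 0" "M + a \<ge> 0"
  shows "\<bar>sqrt (M + a) - sqrt M\<bar> \<le> \<bar>a\<bar> / sqrt M"
proof -
  have "(sqrt (M + a) - sqrt M) * (sqrt (M + a) + sqrt M) = a"
    using assms by (simp add: algebra_simps)
  then have "\<bar>sqrt (M + a) - sqrt M\<bar> * \<bar>sqrt (M + a) + sqrt M\<bar> = \<bar>a\<bar>"
    by (metis abs_mult)
  moreover have "\<bar>sqrt (M + a) - sqrt M\<bar> * sqrt M \<le>
      \<bar>sqrt (M + a) - sqrt M\<bar> * \<bar>sqrt (M + a) + sqrt M\<bar>"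
    using assms by (intro mult_left_mono) auto
  ultimately show ?thesis using assms by (simp add: field_simps)
qed

subsection \<open>Repulsion of solutions\<close>

text \<open>In the bracket, the first term is the cost of replacing \<open>sqrt (M + a i)\<close> by
  \<open>sqrt M\<close>, the second that of replacing \<open>(N + z) powr (k + 1/2)\<close> by a
  Taylor polynomial.\<close>

lemma two_solutions_inequality:
  fixes a w r s :: "'i \<Rightarrow> int" and N M D :: int and A :: real
  assumes I: "finite I" "card I = 3" "inj_on a I"
    and A: "A \<ge> 1" "\<And>i. i \<in> I \<Longrightarrow> \<bar>real_of_int (a i)\<bar> \<le> A"
    and D: "D > 0" "\<And>i j. i \<in> I \<Longrightarrow> j \<in> I \<Longrightarrow> i \<noteq> j \<Longrightarrow> (a i - a j) dvd D"
    and N: "real_of_int N \<ge> 2 * A" "\<And>i. i \<in> I \<Longrightarrow> N + a i = w i * r i ^ 2"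
    and M: "real_of_int M \<ge> 2 * A" "\<And>i. i \<in> I \<Longrightarrow> M + a i = w i * s i ^ 2"
    and rs: "\<And>i. i \<in> I \<Longrightarrow> r i \<ge> 0" "\<And>i. i \<in> I \<Longrightarrow> s i \<ge> 0"
    and k: "k > 0"
  shows "1 \<le> (8192 * A ^ 4 * real_of_int D ^ 3) ^ k *
    (real_of_int N ^ k * sqrt N / sqrt M + sqrt M * sqrt N / real_of_int N ^ (2 * k))"
proof -
  define S where "S = real k + 1 / 2"
  have S: "real (Suc k) - 1 / 2 = S" by (simp add: S_def)
  define b where "b h = S gchoose h" for h
  have b_bound: "\<bar>b h\<bar> \<le> 2 ^ Suc k" for h
    using abs_gbinomial_half_le [of "Suc k" h] unfolding S b_def .
  have b_int: "4 ^ h * b h \<in> \<int>" for h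
    using gbinomial_half_integral [of h "Suc k"] unfolding S b_def .
  have Npos: "real_of_int N > 0" and Mpos: "real_of_int M > 0" using N(1) M(1) A(1) by linarith+
  have Na: "N / 2 \<le> real_of_int N + a i" "real_of_int N + a i \<le> 2 * real_of_int N"
    and Ma: "real_of_int M + a i > 0" if "i \<in> I" for i
    using A(1) A(2) [OF that] N(1) M(1) by (simp_all add: abs_le_iff)
  \<comment> \<open>Both equations share \<open>w i\<close>, so the product of the square roots of
    \<open>N + a i\<close> and \<open>M + a i\<close> is this integer.\<close>
  define v where "v i = real_of_int (w i * r i * s i)" for i
  have v: "v i = sqrt (N + a i) * sqrt (M + a i)" if "i \<in> I" for i
  proof -
    have "N + a i > 0" using Na [OF that] Npos by linarith
    then have "w i * r i ^ 2 > 0" using N(2) [OF that] by simp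
    then have "w i > 0" by (simp add: zero_less_mult_iff)
    then have "v i \<ge> 0" unfolding v_def using rs that by simp
    moreover have "(w i * r i * s i)\<^sup>2 = (N + a i) * (M + a i)"
      unfolding N(2) [OF that] M(2) [OF that] by (simp add: power2_eq_square)
    then have "(v i)\<^sup>2 = (real_of_int N + a i) * (real_of_int M + a i)"
      unfolding v_def by (metis of_int_add of_int_mult of_int_power)
    ultimately show ?thesis
      by (metis of_int_add real_sqrt_mult real_sqrt_unique)
  qed
  \<comment> \<open>Taylor coefficients at \<open>a i\<close> of
    \<open>sqrt (M + a i) * (N + z) powr S\<close>. Only \<open>h \<le> k\<close> occurs, so the
    exponent \<open>k - h\<close> is not truncated and only \<open>b h\<close> has a
    denominator.\<close>
  define \<phi> where "\<phi> i h = b h * v i * real_of_int (N + a i) ^ (k - h)" for i h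
  let ?a = "\<lambda>i. real_of_int (a i)"
  have inj: "inj_on ?a I" using I(3) by (auto simp: inj_on_def)
  let ?\<kappa> = "\<lambda>e. (\<lambda>_. k)(e := Suc k)"
  have sum\<kappa>: "sum (?\<kappa> e) I = 3 * k + 1" if "e \<in> I" for e
  proof -
    have "sum (?\<kappa> e) (I - {e}) = sum (\<lambda>_. k) (I - {e})" by (intro sum.cong) auto
    then show ?thesis using that I(1,2)
      by (subst sum.remove [OF _ that]) (simp_all add: card_Diff_singleton)
  qed
  have \<kappa>_le: "h \<le> k" if "h < ?\<kappa> e i" for h e i using that by (auto split: if_splits)
  have "\<exists>f. degree f < 3 * k + 1 \<and> hermite_interpolates I ?a (?\<kappa> e) \<phi> f \<and>
      4 ^ k * real_of_int D ^ (3 * k) * coeff f (3 * k) \<in> \<int>" if "e \<in> I" for e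
  proof -
    have "4 ^ k * \<phi> i h \<in> \<int>" if "i \<in> I" "h < ?\<kappa> e i" for i h
    proof -
      have "h \<le> k" by (rule \<kappa>_le [OF that(2)])
      then have "(4 :: real) ^ k = 4 ^ (k - h) * 4 ^ h" by (simp flip: power_add)
      then have "4 ^ k * \<phi> i h = (4 ^ (k - h) * (v i * real_of_int (N + a i) ^ (k - h))) * (4 ^ h * b h)"
        unfolding \<phi>_def by (simp only: mult_ac)
      moreover have "4 ^ (k - h) * (v i * real_of_int (N + a i) ^ (k - h)) \<in> \<int>"
        unfolding v_def by (intro Ints_mult Ints_power Ints_of_int Ints_numeral)
      ultimately show ?thesis using b_int by (simp only: Ints_mult)
    qed
    then show ?thesis
      using hermite_exists [OF I(1,3) _ D(2), of "?\<kappa> e" \<phi>] unfolding sum\<kappa> [OF that] by auto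
  qed
  then obtain f where f: "\<And>e. e \<in> I \<Longrightarrow> degree (f e) < 3 * k + 1"
    "\<And>e. e \<in> I \<Longrightarrow> hermite_interpolates I ?a (?\<kappa> e) \<phi> (f e)"
    "\<And>e. e \<in> I \<Longrightarrow> 4 ^ k * real_of_int D ^ (3 * k) * coeff (f e) (3 * k) \<in> \<int>"
    by metis
  obtain i0 where i0: "i0 \<in> I" using I(2) by fastforce
  have "\<exists>e\<in>I. coeff (f e) (card I * k) \<noteq> 0"
  proof (rule hermite_leading_coeff_nonzero [OF I(1) inj _ k, where s = S and \<phi> = \<phi> and x = "real_of_int N" and ?i0.0 = i0])
    show "I \<noteq> {}" using i0 by blast
    show "S \<notin> \<nat>"
    proof
      assume "S \<in> \<nat>"
      then obtain m where "real k + 1 / 2 = real m" by (auto simp: Nats_def S_def)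
      then have "real (2 * k + 1) = real (2 * m)" by simp
      then show False by (simp only: of_nat_eq_iff) presburger
    qed
    show "\<phi> i0 0 \<noteq> 0"
      using v [OF i0] Na [OF i0] Ma [OF i0] Npos unfolding \<phi>_def b_def by simp
    show "(N + ?a i) * (real (Suc h) * \<phi> i (Suc h)) = (S - real h) * \<phi> i h" if "i \<in> I" "h < k" for i h
    proof -
      have *: "real (Suc h) * b (Suc h) = (S - real h) * b h"
        unfolding b_def by (simp only: gbinomial_absorption gbinomial_absorb_comp)
      have "k - h = Suc (k - Suc h)" using that by simp
      then have "real_of_int (N + a i) ^ (k - h) = (N + ?a i) * real_of_int (N + a i) ^ (k - Suc h)"
        by simp
      then have "(S - real h) * \<phi> i h =
          ((S - real h) * b h) * (v i * ((N + ?a i) * real_of_int (N + a i) ^ (k - Suc h)))"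
        unfolding \<phi>_def by (simp only: mult_ac)
      also have "\<dots> = (N + ?a i) * (real (Suc h) * \<phi> i (Suc h))"
        unfolding * [symmetric] \<phi>_def by (simp only: mult_ac)
      finally show ?thesis by simp
    qed
  qed (use i0 f I(2) in auto)
  then obtain e where e: "e \<in> I" "coeff (f e) (3 * k) \<noteq> 0" using I(2) by auto
  define c where "c = coeff (f e) (3 * k)"
  define Q where "Q = 4 ^ k * real_of_int D ^ (3 * k)"
  have "Q > 0" unfolding Q_def using D(1) by simp
  have lower: "1 \<le> Q * \<bar>c\<bar>"
  proof -
    have "Q * c \<in> \<int>" unfolding Q_def c_def by (rule f(3) [OF e(1)])
    moreover have "Q * c \<noteq> 0" using e(2) \<open>Q > 0\<close> unfolding c_def by simp
    ultimately have "1 \<le> \<bar>Q * c\<bar>" by (rule Ints_nonzero_abs_ge1)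
    then show ?thesis using \<open>Q > 0\<close> by (simp add: abs_mult)
  qed

  \<comment> \<open>Subtracting a polynomial of degree below \<open>3 * k\<close> does not change the leading coefficient \<open>c\<close>.\<close>
  define p where "p = (\<Sum>m<3 * k. monom ((S gchoose m) * real_of_int N powr (S - real m)) m)"
  have coeff_p: "coeff p (3 * k) = 0" unfolding p_def by (simp add: coeff_sum)
  have deg_p: "degree p < 3 * k + 1"
  proof -
    have "degree p \<le> 3 * k" unfolding p_def
      by (intro degree_sum_le) (auto intro: order.trans [OF degree_monom_le])
    then show ?thesis by simp
  qed
  define \<psi> where "\<psi> i h = \<phi> i h - sqrt M * coeff (p \<circ>\<^sub>p [:?a i, 1:]) h" for i h
  define X where "X = real_of_int N ^ k * sqrt N / sqrt M"
  define Y where "Y = sqrt M * sqrt N / real_of_int N ^ (2 * k)"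
  have XY: "X \<ge> 0" "Y \<ge> 0" unfolding X_def Y_def using Npos Mpos by simp_all
  have \<psi>_bound: "\<bar>\<psi> i h\<bar> \<le> 4 * A * (64 * A ^ 3) ^ k * (X + Y)" if i: "i \<in> I" and h: "h \<le> k" for i h
  proof -
    let ?n = "real_of_int N + a i" and ?m = "real_of_int M + a i"
    \<comment> \<open>Coefficient \<open>h\<close> of \<open>(N + z) powr S\<close> expanded at
      \<open>a i\<close>. It splits \<open>\<psi> i h\<close> into the error of
      \<open>sqrt M\<close>, bounded through \<open>X\<close>, and \<open>sqrt M\<close> times the
      error of \<open>p\<close>, bounded through \<open>Y\<close>.\<close>
    let ?\<gamma> = "b h * ?n powr (S - real h)"
    have npos: "?n > 0" using Na [OF i] Npos by linarith
    have "?n powr (S - real h) = ?n powr (real (k - h) + 1 / 2)" using h by (simp add: S_def of_nat_diff algebra_simps)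
    also have "\<dots> = ?n ^ (k - h) * sqrt ?n" using npos by (simp add: powr_add powr_realpow powr_half_sqrt)
    finally have \<gamma>: "?\<gamma> = b h * (?n ^ (k - h) * sqrt ?n)" by simp
    have "\<phi> i h - sqrt M * ?\<gamma> = b h * ?n ^ (k - h) * sqrt ?n * (sqrt ?m - sqrt M)"
      unfolding \<gamma> \<phi>_def v [OF i] by (simp add: algebra_simps)
    then have "\<bar>\<phi> i h - sqrt M * ?\<gamma>\<bar> = \<bar>b h\<bar> * ?n ^ (k - h) * sqrt ?n * \<bar>sqrt ?m - sqrt M\<bar>"
      using npos by (simp add: abs_mult)
    also have "\<dots> \<le> 2 ^ Suc k * (2 * real_of_int N) ^ k * (2 * sqrt N) * (A / sqrt M)"
    proof (intro mult_mono)
      have "?n ^ (k - h) \<le> (2 * real_of_int N) ^ (k - h)" using Na [OF i] npos by (intro power_mono) auto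
      also have "\<dots> \<le> (2 * real_of_int N) ^ k" using N(1) A(1) by (intro power_increasing) auto
      finally show "?n ^ (k - h) \<le> (2 * real_of_int N) ^ k" by simp
      have "sqrt ?n \<le> sqrt (2\<^sup>2 * real_of_int N)" using Na [OF i] Npos by (intro real_sqrt_le_mono) simp
      then show "sqrt ?n \<le> 2 * sqrt N" by (simp only: real_sqrt_mult real_sqrt_pow2) simp
      have "\<bar>sqrt ?m - sqrt M\<bar> \<le> \<bar>?a i\<bar> / sqrt M"
        using Mpos Ma [OF i] by (intro abs_sqrt_add_diff_le) auto
      also have "\<dots> \<le> A / sqrt M" using A(2) [OF i] Mpos by (intro divide_right_mono) auto
      finally show "\<bar>sqrt ?m - sqrt M\<bar> \<le> A / sqrt M" .
    qed (use b_bound Npos npos A(1) in auto)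
    also have "\<dots> = 4 * A * 4 ^ k * X"
    proof -
      have "(4 :: real) ^ k = 2 ^ k * 2 ^ k" by (simp flip: power_mult_distrib)
      then show ?thesis unfolding X_def by (simp add: power_mult_distrib)
    qed
    finally have 1: "\<bar>\<phi> i h - sqrt M * ?\<gamma>\<bar> \<le> 4 * A * 4 ^ k * X" .

    have "\<bar>?a i\<bar> < N" using A(1) A(2) [OF i] N(1) by linarith
    moreover have "h \<le> 3 * k" using h by simp
    ultimately have "\<exists>\<xi>. \<bar>\<xi>\<bar> \<le> \<bar>?a i\<bar> \<and> ?\<gamma> - coeff (p \<circ>\<^sub>p [:?a i, 1:]) h =
        b (3 * k) * real ((3 * k) choose h) * (real_of_int N + \<xi>) powr (S - real (3 * k)) * ?a i ^ (3 * k - h)"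
      unfolding b_def p_def by (rule powr_taylor_poly)
    then obtain \<xi> where \<xi>: "\<bar>\<xi>\<bar> \<le> \<bar>?a i\<bar>" "?\<gamma> - coeff (p \<circ>\<^sub>p [:?a i, 1:]) h =
        b (3 * k) * real ((3 * k) choose h) * (real_of_int N + \<xi>) powr (S - real (3 * k)) * ?a i ^ (3 * k - h)"
      by blast
    have "\<bar>?\<gamma> - coeff (p \<circ>\<^sub>p [:?a i, 1:]) h\<bar> =
        \<bar>b (3 * k)\<bar> * real ((3 * k) choose h) * (real_of_int N + \<xi>) powr (S - real (3 * k)) * \<bar>?a i\<bar> ^ (3 * k - h)"
      unfolding \<xi>(2) by (simp add: abs_mult power_abs)
    also have "\<dots> \<le> 2 ^ Suc k * 2 ^ (3 * k) * (4 ^ k * (sqrt N / real_of_int N ^ (2 * k))) * A ^ (3 * k)"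
    proof (intro mult_mono)
      have "(3 * k) choose h \<le> 2 ^ (3 * k)" by (rule binomial_le_pow2)
      then show "real ((3 * k) choose h) \<le> 2 ^ (3 * k)" by (metis of_nat_le_iff of_nat_numeral of_nat_power)
      have half: "N / 2 \<le> real_of_int N + \<xi>" using \<xi>(1) A(2) [OF i] N(1) by linarith
      \<comment> \<open>The exponent is \<open>1/2 - 2 * k < 0\<close>, so a lower bound on the base
        is what is needed; the halves produce the factor \<open>4 ^ k\<close>.\<close>
      have "(real_of_int N + \<xi>) powr (S - real (3 * k)) \<le> (N / 2) powr (S - real (3 * k))"
        using half Npos k by (intro powr_mono2') (auto simp: S_def)
      also have "(N / 2) powr (S - real (3 * k)) = (N / 2) powr (1 / 2 - real (2 * k))" by (simp add: S_def)
      also have "\<dots> = sqrt (N / 2) / (N / 2) ^ (2 * k)"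
        using Npos by (simp add: powr_diff powr_half_sqrt flip: powr_realpow)
      also have "\<dots> \<le> sqrt N / (N / 2) ^ (2 * k)"
        using Npos by (intro divide_right_mono) auto
      also have "\<dots> = 4 ^ k * (sqrt N / real_of_int N ^ (2 * k))"
        by (simp add: power_divide power_mult)
      finally show "(real_of_int N + \<xi>) powr (S - real (3 * k)) \<le> 4 ^ k * (sqrt N / real_of_int N ^ (2 * k))" .
      have "\<bar>?a i\<bar> ^ (3 * k - h) \<le> A ^ (3 * k - h)" using A(2) [OF i] by (intro power_mono) auto
      also have "\<dots> \<le> A ^ (3 * k)" using A(1) by (intro power_increasing) auto
      finally show "\<bar>?a i\<bar> ^ (3 * k - h) \<le> A ^ (3 * k)" .
    qed (use b_bound Npos A(1) in auto)
    finally have "sqrt M * \<bar>?\<gamma> - coeff (p \<circ>\<^sub>p [:?a i, 1:]) h\<bar> \<le>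
        sqrt M * (2 ^ Suc k * 2 ^ (3 * k) * (4 ^ k * (sqrt N / real_of_int N ^ (2 * k))) * A ^ (3 * k))"
      using Mpos by (intro mult_left_mono) auto
    also have "\<dots> = 2 * (64 * A ^ 3) ^ k * Y"
    proof -
      have "(64 * A ^ 3) ^ k = 2 ^ k * 2 ^ (3 * k) * 4 ^ k * A ^ (3 * k)"
      proof -
        have "64 * A ^ 3 = 2 * 2 ^ 3 * 4 * A ^ 3" by simp
        then show ?thesis by (simp only: power_mult power_mult_distrib)
      qed
      then show ?thesis unfolding Y_def by simp
    qed
    finally have 2: "sqrt M * \<bar>?\<gamma> - coeff (p \<circ>\<^sub>p [:?a i, 1:]) h\<bar> \<le> 2 * (64 * A ^ 3) ^ k * Y" .

    have "\<psi> i h = (\<phi> i h - sqrt M * ?\<gamma>) + sqrt M * (?\<gamma> - coeff (p \<circ>\<^sub>p [:?a i, 1:]) h)"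
      unfolding \<psi>_def by (simp add: algebra_simps)
    then have "\<bar>\<psi> i h\<bar> \<le> \<bar>\<phi> i h - sqrt M * ?\<gamma>\<bar> + \<bar>sqrt M * (?\<gamma> - coeff (p \<circ>\<^sub>p [:?a i, 1:]) h)\<bar>"
      by (simp only: abs_triangle_ineq)
    also have "\<bar>sqrt M * (?\<gamma> - coeff (p \<circ>\<^sub>p [:?a i, 1:]) h)\<bar> =
        sqrt M * \<bar>?\<gamma> - coeff (p \<circ>\<^sub>p [:?a i, 1:]) h\<bar>"
      using Mpos by (simp add: abs_mult)
    also have "\<bar>\<phi> i h - sqrt M * ?\<gamma>\<bar> + \<dots> \<le> 4 * A * 4 ^ k * X + 2 * (64 * A ^ 3) ^ k * Y"
      using 1 2 by (rule add_mono)
    also have "\<dots> \<le> 4 * A * (64 * A ^ 3) ^ k * X + 4 * A * (64 * A ^ 3) ^ k * Y"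
    proof (intro add_mono mult_right_mono mult_left_mono)
      have "A ^ 3 \<ge> 1" using A(1) by (rule one_le_power)
      then show "(4 :: real) ^ k \<le> (64 * A ^ 3) ^ k" by (intro power_mono) auto
    qed (use A(1) XY in auto)
    finally show ?thesis by (simp add: algebra_simps)
  qed

  obtain g where g: "degree g < 3 * k + 1" "hermite_interpolates I ?a (?\<kappa> e) \<psi> g"
    "\<And>B. (\<forall>i\<in>I. \<forall>h<?\<kappa> e i. \<bar>\<psi> i h\<bar> \<le> B) \<Longrightarrow> \<bar>coeff g (3 * k)\<bar> \<le> 2 ^ (3 * k) * B"
    using hermite_exists [OF I(1,3) _ D(2), of "?\<kappa> e" \<psi>] unfolding sum\<kappa> [OF e(1)] by auto
  have "g = f e - smult (sqrt M) p"
  proof (rule hermite_unique [OF I(1) inj g(2)])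
    show "hermite_interpolates I ?a (?\<kappa> e) \<psi> (f e - smult (sqrt M) p)"
      using f(2) [OF e(1)] unfolding hermite_interpolates_def \<psi>_def
      by (simp only: pcompose_diff pcompose_smult coeff_diff coeff_smult) simp
    show "degree g < sum (?\<kappa> e) I" unfolding sum\<kappa> [OF e(1)] by (rule g(1))
    show "degree (f e - smult (sqrt M) p) < sum (?\<kappa> e) I" unfolding sum\<kappa> [OF e(1)]
      using f(1) [OF e(1)] deg_p by (intro degree_diff_less) auto
  qed
  then have "coeff g (3 * k) = c" by (simp add: coeff_p c_def)
  moreover have "\<bar>coeff g (3 * k)\<bar> \<le> 2 ^ (3 * k) * (4 * A * (64 * A ^ 3) ^ k * (X + Y))"
    by (intro g(3) ballI allI impI \<psi>_bound \<kappa>_le)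
  ultimately have "\<bar>c\<bar> \<le> 2 ^ (3 * k) * (4 * A * (64 * A ^ 3) ^ k * (X + Y))" by simp
  \<comment> \<open>As \<open>4 * A \<ge> 1\<close> and \<open>k > 0\<close>, the lone factor is
    absorbed and the constant becomes a pure \<open>k\<close>-th power.\<close>
  also have "\<dots> \<le> 2 ^ (3 * k) * ((4 * A) ^ k * (64 * A ^ 3) ^ k * (X + Y))"
    using A(1) k XY by (intro mult_left_mono mult_right_mono self_le_power) auto
  finally have "Q * \<bar>c\<bar> \<le> Q * (2 ^ (3 * k) * ((4 * A) ^ k * (64 * A ^ 3) ^ k * (X + Y)))"
    using \<open>Q > 0\<close> by (intro mult_left_mono) auto
  also have "\<dots> = (8192 * A ^ 4 * real_of_int D ^ 3) ^ k * (X + Y)"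
  proof -
    \<comment> \<open>The base collects 4 from the binomial denominators, \<open>D ^ 3\<close> from
      the node differences, \<open>2 ^ 3\<close> from the growth in interpolation and
      \<open>4 * A * (64 * A ^ 3)\<close> from the bound on \<open>\<psi>\<close>.\<close>
    have "Q * (2 ^ (3 * k) * ((4 * A) ^ k * (64 * A ^ 3) ^ k)) = (4 * real_of_int D ^ 3 * (2 ^ 3 * (4 * A * (64 * A ^ 3)))) ^ k"
      unfolding Q_def by (simp only: power_mult power_mult_distrib)
    also have "4 * real_of_int D ^ 3 * (2 ^ 3 * (4 * A * (64 * A ^ 3))) = 8192 * A ^ 4 * real_of_int D ^ 3"
      by (simp add: power4_eq_xxxx power3_eq_cube)
    finally show ?thesis by (simp only: mult.assoc [symmetric])
  qed
  finally show ?thesis using lower unfolding X_def Y_def by linarith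
qed

text \<open>With \<open>q\<close> the fourth root of \<open>N\<close> and \<open>R = sqrt M\<close>,
  choose \<open>k\<close> with \<open>q ^ (5 * k + 2) < R \<le> q ^ (5 * k + 7)\<close>; consecutive
  windows of this form adjoin. The lower end controls the first term, the upper end the second as
  soon as \<open>6 * k + 9 \<le> 8 * k\<close>.\<close>

lemma exponent_choice:
  fixes C N M :: real
  assumes "C \<ge> 1" "N \<ge> (2 * C) ^ 4" "M \<ge> N ^ 14"
  shows "\<exists>k>0. C ^ k * (N ^ k * sqrt N / sqrt M + sqrt M * sqrt N / N ^ (2 * k)) < 1"
proof -
  define q where "q = sqrt (sqrt N)"
  define R where "R = sqrt M"
  have N0: "N \<ge> 0" using assms(2) by (rule order.trans [rotated]) simp
  then have q2: "sqrt N = q ^ 2" by (simp add: q_def)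
  have q4: "N = q ^ 4"
    using N0 q2 by (metis power2_eq_square real_sqrt_pow2 power_mult [of q 2 2] mult_2 numeral_Bit0)
  have "q \<ge> 0" using N0 by (simp add: q_def)
  then have q: "q \<ge> 2 * C"
    using assms(1,2) power_mono_iff [of "2 * C" q 4] unfolding q4 by simp
  then have q1: "q > 1" using assms(1) by linarith
  have "sqrt (q ^ 56) = q ^ 28" using q1 by (intro real_sqrt_unique) auto
  moreover have "q ^ 56 \<le> M" using assms(3) unfolding q4 by (simp flip: power_mult)
  ultimately have R: "R \<ge> q ^ 28" unfolding R_def by (metis real_sqrt_le_iff)
  define P where "P j \<longleftrightarrow> R \<le> q ^ (5 * j + 7)" for j :: nat
  obtain j where "R < q ^ j" using real_arch_pow [OF q1] by blast
  also have "q ^ j \<le> q ^ (5 * j + 7)" using q1 by (intro power_increasing) auto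
  finally have "P j" by (simp add: P_def)
  define k where "k = (LEAST j. P j)"
  have Pk: "P k" unfolding k_def by (rule LeastI) fact
  then have "q ^ 28 \<le> q ^ (5 * k + 7)" using R by (simp add: P_def)
  \<comment> \<open>The exponent 14 gives 28 here, just above \<open>5 * 4 + 7\<close>, which
    excludes \<open>k \<le> 4\<close>.\<close>
  then have k5: "k \<ge> 5" using q1 by (simp add: power_increasing_iff)
  then have "\<not> P (k - 1)" unfolding k_def by (intro not_less_Least) simp
  moreover have "5 * (k - 1) + 7 = 5 * k + 2" using k5 by simp
  ultimately have low: "q ^ (5 * k + 2) < R" unfolding P_def by (simp only: not_le)
  have up: "R \<le> q ^ (5 * k + 7)" using Pk by (simp add: P_def)
  have R0: "R > 0" using low q1 by (meson less_trans zero_less_power zero_less_one)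
  \<comment> \<open>The factor 2 in \<open>q \<ge> 2 * C\<close> is kept to leave each of the two
    terms at most \<open>1/2\<close>.\<close>
  have "C ^ k \<le> (q / 2) ^ k" using q assms(1) by (intro power_mono) auto
  also have "\<dots> \<le> q ^ k / 2"
    using self_le_power [of "2 :: real" k] k5 q1 unfolding power_divide by (intro divide_left_mono) auto
  finally have Ck: "C ^ k \<le> q ^ k / 2" .
  have Nk: "N ^ k = q ^ (4 * k)" "N ^ (2 * k) = q ^ (8 * k)"
    unfolding q4 by (simp_all flip: power_mult)
  have "C ^ k * (N ^ k * sqrt N / R) \<le> q ^ k / 2 * (N ^ k * sqrt N / R)"
    using Ck R0 N0 by (intro mult_right_mono) auto
  also have "\<dots> = q ^ (5 * k + 2) / (2 * R)"
    unfolding Nk q2 by (simp flip: power_add)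
  also have "\<dots> < 1 / 2" using low R0 by (simp add: field_simps)
  finally have 1: "C ^ k * (N ^ k * sqrt N / R) < 1 / 2" .
  have "C ^ k * (R * sqrt N / N ^ (2 * k)) \<le> q ^ k / 2 * (q ^ (5 * k + 7) * sqrt N / N ^ (2 * k))"
    using Ck R0 N0 up q1 by (intro mult_mono divide_right_mono mult_right_mono) auto
  also have "\<dots> = q ^ (6 * k + 9) / (2 * q ^ (8 * k))"
    unfolding Nk q2 by (simp flip: power_add)
  also have "\<dots> \<le> 1 / 2"
    using power_increasing [of "6 * k + 9" "8 * k" q] k5 q1 by (simp add: field_simps)
  finally have 2: "C ^ k * (R * sqrt N / N ^ (2 * k)) \<le> 1 / 2" .
  have "C ^ k * (N ^ k * sqrt N / R + R * sqrt N / N ^ (2 * k)) < 1"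
    using 1 2 unfolding distrib_left by linarith
  with k5 show ?thesis unfolding R_def by (intro exI [of _ k]) auto
qed

text \<open>Unboundedness would supply a large solution \<open>N\<close> and another beyond
  \<open>N ^ 14\<close>. The argument is ineffective: the bound depends on an unknown large
  solution.\<close>

lemma simultaneous_squares_bounded:
  fixes a w :: "'i \<Rightarrow> int"
  assumes I: "finite I" "card I = 3" "inj_on a I"
  shows "\<exists>B. \<forall>N. (\<forall>i\<in>I. \<exists>r. N + a i = w i * r ^ 2) \<longrightarrow> N \<le> B"
proof (rule ccontr)
  assume "\<not> ?thesis"
  then have large: "\<exists>N>B. \<forall>i\<in>I. \<exists>r. N + a i = w i * r ^ 2" for B by (meson linorder_not_le)
  have roots: "\<exists>r. \<forall>i\<in>I. r i \<ge> 0 \<and> N + a i = w i * r i ^ 2"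
    if "\<forall>i\<in>I. \<exists>r. N + a i = w i * r ^ 2" for N
  proof -
    have "\<forall>i\<in>I. \<exists>r\<ge>0. N + a i = w i * r ^ 2" using that by (metis abs_ge_zero power2_abs)
    then show ?thesis by (rule bchoice [of I, where Q = "\<lambda>i r. r \<ge> 0 \<and> N + a i = w i * r ^ 2"])
  qed
  define A where "A = 1 + real_of_int (\<Sum>i\<in>I. \<bar>a i\<bar>)"
  have A: "A \<ge> 1" unfolding A_def by (simp add: sum_nonneg)
  have aA: "\<bar>real_of_int (a i)\<bar> \<le> A" if "i \<in> I" for i
  proof -
    have "\<bar>a i\<bar> \<le> (\<Sum>i\<in>I. \<bar>a i\<bar>)" using that I(1) by (intro member_le_sum) auto
    then have "real_of_int \<bar>a i\<bar> \<le> real_of_int (\<Sum>i\<in>I. \<bar>a i\<bar>)" by (simp only: of_int_le_iff)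
    then show ?thesis unfolding A_def by simp
  qed
  \<comment> \<open>The product of all node differences is a common multiple of them, as the
    denominators of the interpolants require.\<close>
  define D where "D = (\<Prod>(i, j)\<in>{p \<in> I \<times> I. fst p \<noteq> snd p}. \<bar>a i - a j\<bar>)"
  have D: "D > 0" unfolding D_def using I(3) by (intro prod_pos) (auto dest: inj_onD)
  have dvd: "(a i - a j) dvd D" if "i \<in> I" "j \<in> I" "i \<noteq> j" for i j
  proof -
    have "(case (i, j) of (i, j) \<Rightarrow> \<bar>a i - a j\<bar>) dvd D"
      unfolding D_def using that I(1) by (intro dvd_prodI) auto
    then show ?thesis by simp
  qed
  define C where "C = 8192 * A ^ 4 * real_of_int D ^ 3"
  have "1 * 1 * 1 \<le> 8192 * A ^ 4 * real_of_int D ^ 3"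
    using A D by (intro mult_mono one_le_power) auto
  then have C: "C \<ge> 1" by (simp add: C_def)
  \<comment> \<open>The summand \<open>2 * A\<close> keeps the nodes small compared with
    \<open>N\<close>; \<open>(2 * C) ^ 4\<close> is the threshold for choosing
    \<open>k\<close>.\<close>
  obtain N where N: "N > \<lceil>(2 * C) ^ 4 + 2 * A\<rceil>" "\<forall>i\<in>I. \<exists>r. N + a i = w i * r ^ 2"
    using large by blast
  obtain M where M: "M > N ^ 14" "\<forall>i\<in>I. \<exists>r. M + a i = w i * r ^ 2"
    using large by blast
  obtain r s where r: "\<forall>i\<in>I. r i \<ge> 0 \<and> N + a i = w i * r i ^ 2"
    and s: "\<forall>i\<in>I. s i \<ge> 0 \<and> M + a i = w i * s i ^ 2"
    using roots [OF N(2)] roots [OF M(2)] by blast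
  have Nbig: "real_of_int N \<ge> (2 * C) ^ 4 + 2 * A" using N(1) by linarith
  moreover have "(2 * C) ^ 4 \<ge> 0" by simp
  ultimately have N2: "real_of_int N \<ge> 2 * A" "real_of_int N \<ge> (2 * C) ^ 4" using A by linarith+
  have "real_of_int N \<ge> 1" using N2(1) A by linarith
  then have "real_of_int N ^ 1 \<le> real_of_int N ^ 14" by (intro power_increasing) auto
  moreover have M14: "real_of_int M \<ge> real_of_int N ^ 14"
    using M(1) by (metis less_imp_le of_int_le_iff of_int_power)
  ultimately have M2: "real_of_int M \<ge> 2 * A" using N2(1) by simp
  obtain k where "k > 0" and k: "C ^ k *
      (real_of_int N ^ k * sqrt N / sqrt M + sqrt M * sqrt N / real_of_int N ^ (2 * k)) < 1"
    using exponent_choice [OF C N2(2) M14] by blast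
  moreover have "1 \<le> C ^ k *
      (real_of_int N ^ k * sqrt N / sqrt M + sqrt M * sqrt N / real_of_int N ^ (2 * k))"
    unfolding C_def
    by (rule two_solutions_inequality [OF I A aA D dvd N2(1) _ M2 _ _ _ \<open>k > 0\<close>, where w = w and r = r and s = s])
      (use r s in auto)
  ultimately show False by linarith
qed

section \<open>Elimination and the finiteness theorem\<close>

lemma diagonal_system_bounded:
  fixes a1 b1 c1 d1 a2 b2 c2 d2 :: int
  assumes "a1 * b2 - a2 * b1 \<noteq> 0"
      and "a1 * c2 - a2 * c1 \<noteq> 0"
      and ad: "a1 * d2 - a2 * d1 \<noteq> 0"
      and "b1 * c2 - b2 * c1 \<noteq> 0"
      and "b1 * d2 - b2 * d1 \<noteq> 0"
      and "c1 * d2 - c2 * d1 \<noteq> 0"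
  shows "\<exists>B. \<forall>x y z. a1 * x^2 + b1 * y^2 + c1 * z^2 = d1 \<longrightarrow>
            a2 * x^2 + b2 * y^2 + c2 * z^2 = d2 \<longrightarrow> \<bar>x\<bar> \<le> B"
proof -
  \<comment> \<open>Eliminating \<open>z\<close> gives
    \<open>p * x\<^sup>2 + t * y\<^sup>2 = u\<close>, eliminating \<open>y\<close> gives
    \<open>q * x\<^sup>2 - t * z\<^sup>2 = v\<close>. Multiplying by \<open>\<sigma> * q\<close> and
    \<open>\<sigma> * p\<close> makes the \<open>x\<close> terms of both equal to
    \<open>N\<close>.\<close>
  define p q t where "p = a1 * c2 - a2 * c1" and "q = a1 * b2 - a2 * b1" and "t = b1 * c2 - b2 * c1"
  define u v where "u = d1 * c2 - d2 * c1" and "v = d1 * b2 - d2 * b1"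
  \<comment> \<open>The sign makes \<open>N = \<sigma> * p * q * x\<^sup>2\<close> below nonnegative.\<close>
  define \<sigma> where "\<sigma> = sgn (p * q)"
  have nz: "p \<noteq> 0" "q \<noteq> 0" "t \<noteq> 0" "u \<noteq> 0" "v \<noteq> 0"
    using assms by (auto simp: p_def q_def t_def u_def v_def mult.commute)
  then have "\<sigma> \<noteq> 0" by (simp add: \<sigma>_def sgn_0_0)
  \<comment> \<open>A Pluecker relation among the minors: it separates the second and third nodes,
    while \<open>u\<close> and \<open>v\<close> being nonzero separates them from the node
    0.\<close>
  have "q * u - p * v = t * (a1 * d2 - a2 * d1)"
    unfolding p_def q_def t_def u_def v_def by (simp add: algebra_simps)
  then have "q * u \<noteq> p * v" using nz(3) ad by auto
  define a where "a i = (if i = 0 then 0 else if i = 1 then - \<sigma> * q * u else - \<sigma> * p * v)" for i :: nat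
  define w where "w i = (if i = 0 then \<sigma> * p * q else if i = 1 then - \<sigma> * q * t else \<sigma> * p * t)" for i :: nat
  have "inj_on a {0, 1, 2}"
    using nz \<open>\<sigma> \<noteq> 0\<close> \<open>q * u \<noteq> p * v\<close> by (auto simp: inj_on_def a_def mult.assoc)
  then obtain B where B: "\<And>N. (\<forall>i\<in>{0, 1, 2}. \<exists>r. N + a i = w i * r ^ 2) \<Longrightarrow> N \<le> B"
    using simultaneous_squares_bounded [of "{0, 1, 2}" a w] by (elim meta_impE) (simp, simp, simp, blast)
  show ?thesis
  proof (intro exI [of _ B] allI impI)
    fix x y z
    assume e: "a1 * x^2 + b1 * y^2 + c1 * z^2 = d1" "a2 * x^2 + b2 * y^2 + c2 * z^2 = d2"
    define N where "N = \<sigma> * p * q * x\<^sup>2"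
    have "p * x\<^sup>2 + t * y\<^sup>2 = u" "q * x\<^sup>2 - t * z\<^sup>2 = v"
      unfolding p_def q_def t_def u_def v_def e [symmetric] by (simp_all add: algebra_simps)
    then have "N + a 0 = w 0 * x\<^sup>2" "N + a 1 = w 1 * y\<^sup>2" "N + a 2 = w 2 * z\<^sup>2"
      unfolding N_def a_def w_def by (auto simp: algebra_simps)
    then have "\<forall>i\<in>{0, 1, 2}. \<exists>r. N + a i = w i * r ^ 2" by blast
    then have "N \<le> B" by (rule B)
    moreover have "N = \<bar>p * q\<bar> * x\<^sup>2" unfolding N_def \<sigma>_def by (simp add: abs_sgn mult_ac)
    moreover have "1 * x\<^sup>2 \<le> \<bar>p * q\<bar> * x\<^sup>2"
    proof (intro mult_right_mono)
      have "p * q \<noteq> 0" using nz by simp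
      then show "1 \<le> \<bar>p * q\<bar>" by linarith
    qed simp
    moreover have "\<bar>x\<bar> \<le> x\<^sup>2"
      using self_le_power [of "\<bar>x\<bar>" 2] by (cases "x = 0") auto
    ultimately show "\<bar>x\<bar> \<le> B" by linarith
  qed
qed

theorem theorem6:
  fixes a1 b1 c1 d1 a2 b2 c2 d2 :: int
  assumes "a1 * b2 - a2 * b1 \<noteq> 0"
      and "a1 * c2 - a2 * c1 \<noteq> 0"
      and "a1 * d2 - a2 * d1 \<noteq> 0"
      and "b1 * c2 - b2 * c1 \<noteq> 0"
      and "b1 * d2 - b2 * d1 \<noteq> 0"
      and "c1 * d2 - c2 * d1 \<noteq> 0"
  shows "finite {(x :: int, y :: int, z :: int).
            a1 * x^2 + b1 * y^2 + c1 * z^2 = d1 \<and>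
            a2 * x^2 + b2 * y^2 + c2 * z^2 = d2}"
proof -
  obtain X where X: "\<And>x y z. a1 * x^2 + b1 * y^2 + c1 * z^2 = d1 \<Longrightarrow>
      a2 * x^2 + b2 * y^2 + c2 * z^2 = d2 \<Longrightarrow> \<bar>x\<bar> \<le> X"
    using diagonal_system_bounded [OF assms] by blast
  \<comment> \<open>Permuting the first three columns changes the minors only by sign and order, so
    the bound on the first variable applies to each.\<close>
  have "\<exists>B. \<forall>y x z. b1 * y^2 + a1 * x^2 + c1 * z^2 = d1 \<longrightarrow>
      b2 * y^2 + a2 * x^2 + c2 * z^2 = d2 \<longrightarrow> \<bar>y\<bar> \<le> B"
    by (rule diagonal_system_bounded) (use assms in \<open>auto simp: mult.commute\<close>)
  then obtain Y where Y: "\<And>y x z. b1 * y^2 + a1 * x^2 + c1 * z^2 = d1 \<Longrightarrow>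
      b2 * y^2 + a2 * x^2 + c2 * z^2 = d2 \<Longrightarrow> \<bar>y\<bar> \<le> Y"
    by blast
  have "\<exists>B. \<forall>z x y. c1 * z^2 + a1 * x^2 + b1 * y^2 = d1 \<longrightarrow>
      c2 * z^2 + a2 * x^2 + b2 * y^2 = d2 \<longrightarrow> \<bar>z\<bar> \<le> B"
    by (rule diagonal_system_bounded) (use assms in \<open>auto simp: mult.commute\<close>)
  then obtain Z where Z: "\<And>z x y. c1 * z^2 + a1 * x^2 + b1 * y^2 = d1 \<Longrightarrow>
      c2 * z^2 + a2 * x^2 + b2 * y^2 = d2 \<Longrightarrow> \<bar>z\<bar> \<le> Z"
    by blast
  show ?thesis
  proof (rule finite_subset [of _ "{-X..X} \<times> {-Y..Y} \<times> {-Z..Z}"])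
    show "{(x, y, z). a1 * x^2 + b1 * y^2 + c1 * z^2 = d1 \<and> a2 * x^2 + b2 * y^2 + c2 * z^2 = d2}
        \<subseteq> {-X..X} \<times> {-Y..Y} \<times> {-Z..Z}"
    proof
      fix t
      assume "t \<in> {(x, y, z). a1 * x^2 + b1 * y^2 + c1 * z^2 = d1 \<and> a2 * x^2 + b2 * y^2 + c2 * z^2 = d2}"
      then obtain x y z where t: "t = (x, y, z)"
        and e: "a1 * x^2 + b1 * y^2 + c1 * z^2 = d1" "a2 * x^2 + b2 * y^2 + c2 * z^2 = d2"
        by blast
      have "\<bar>x\<bar> \<le> X" by (rule X [OF e])
      moreover have "\<bar>y\<bar> \<le> Y" using e by (intro Y [of y x z]) linarith+
      moreover have "\<bar>z\<bar> \<le> Z" using e by (intro Z [of z x y]) linarith+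
      ultimately show "t \<in> {-X..X} \<times> {-Y..Y} \<times> {-Z..Z}"
        by (simp add: t abs_le_iff)
    qed
  qed auto
qed

end
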